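(* Assume that the system $x'=A(t)x$ has a uniform bounded $h$-growth on $[e_{\ast},+\infty)$. Then the following three statements are equivalent: (i) The system has a uniform $h$-dichotomy on $[e_{\ast},+\infty)$. (ii) The system is $h$-expansive on $[e_{\ast},+\infty)$. (iii) The system is uniformly $h$-noncritical on $[e_{\ast},+\infty)$. Moreover, without the assumption of uniform bounded $h$-growth, the implications (i)$\Rightarrow$(ii)$\Rightarrow$(iii) still hold.
   Context: Let $J=(a_0,+\infty)$ with $a_0\in\mathbb{R}$, or $J=\mathbb{R}$ (i.e. $a_0=-\infty$). Let $A\colon J\to M_n(\mathbb{R})$ be continuous and consider the linear system $x'=A(t)x$, $t\in J$. $\Phi(t)$ denotes a fundamental matrix and $\Phi(t,s)=\Phi(t)\Phi^{-1}(s)$ the transition matrix. $|\cdot|$ is a norm on $\mathbb{R}^n$ and $\|\cdot\|$ its induced matrix norm. A growth rate is a strictly increasing homeomorphism $h\colon J\to(0,+\infty)$; $h$ is a fixed growth rate. On $J$ define the abelian group operation $t\ast s:=h^{-1}(h(t)h(s))$, with unit $e_{\ast}:=h^{-1}(1)$ and inverse $t^{\ast-1}:=h^{-1}(1/h(t))$. Define $|t|_{\ast}=t$ if $e_{\ast}\leq t$ and $|t|_{\ast}=t^{\ast-1}$ if $t<e_{\ast}$. Thus, for $T>e_\ast$, $|u\ast t^{\ast-1}|_{\ast}\leq T$ means $t\ast T^{\ast-1}\leq u\leq t\ast T$. Definitions, for an interval $\mathcal{I}\subset J$: - Uniform $h$-dichotomy on $\mathcal{I}$: there exist projectors $P(t)$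 ($P(t)^2=P(t)$, $t\in J$) and constants $K\geq 1$, $\alpha>0$ such that $P(t)\Phi(t,s)=\Phi(t,s)P(s)$ for all $t,s\in J$, and, with $Q(t)=I-P(t)$: $\|\Phi(t,s)P(s)\|\leq K(h(t)/h(s))^{-\alpha}$ for all $t\geq s$ with $t,s\in\mathcal{I}$, and $\|\Phi(t,s)Q(s)\|\leq K(h(s)/h(t))^{-\alpha}$ for all $s\geq t$ with $t,s\in\mathcal{I}$. - Uniform bounded $h$-growth on $\mathcal{I}$: for some $T>e_{\ast}$ there exists $C_T\geq 1$ such that any solution $x$ of the system verifies $|x(t)|\leq C_T|x(s)|$ for any $s\in\mathcal{I}$ and $t\in[s,s\ast T]\cap\mathcal{I}$. - $h$-expansive on $\mathcal{I}$: there exist positive constants $L,\beta$ such that for any solution $x$ of the system and any $[a,b]\subset\mathcal{I}$, $|x(t)|\leq L\left[h(t\ast a^{\ast-1})^{-\beta}|x(a)|+h(b\ast t^{\ast-1})^{-\beta}|x(b)|\right]$ for $a\leq t\leq b$. - Uniformly $h$-noncritical on $[e_{\ast},+\infty)$: there exist $T>e_{\ast}$ and $\theta\in(0,1)$ such that any solution $x$ of the system satisfies $|x(t)|\leq\theta\sup_{|u\ast t^{\ast-1}|_{\ast}\leq T}|x(u)|$ for all $t\geq T$. *)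

theory Defs
  imports "HOL-Analysis.Analysis"
begin

definition admissible_domain :: "real set \<Rightarrow> bool" where
  "admissible_domain J \<longleftrightarrow> J = UNIV \<or> (\<exists>a\<^sub>0. J = {a\<^sub>0<..})"

definition vector_norm :: "(real ^ 'n \<Rightarrow> real) \<Rightarrow> bool" where
  "vector_norm N \<longleftrightarrow>
     (\<forall>x. 0 \<le> N x) \<and>
     (\<forall>x. N x = 0 \<longleftrightarrow> x = 0) \<and>
     (\<forall>c x. N (c *\<^sub>R x) = \<bar>c\<bar> * N x) \<and>
     (\<forall>x y. N (x + y) \<le> N x + N y)"

definition induced_norm :: "(real ^ 'n \<Rightarrow> real) \<Rightarrow> real ^ 'n ^ 'n \<Rightarrow> real" where
  "induced_norm N M = (SUP x\<in>{x. N x = 1}. N (M *v x))"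

text \<open>Since an admissible domain is open, the derivative within \<open>J\<close> is the ordinary derivative.
  Values of solutions outside \<open>J\<close> are irrelevant.\<close>

definition solution :: "real set \<Rightarrow> (real \<Rightarrow> real ^ 'n ^ 'n) \<Rightarrow> (real \<Rightarrow> real ^ 'n) \<Rightarrow> bool" where
  "solution J A x \<longleftrightarrow> (\<forall>t\<in>J. (x has_vector_derivative A t *v x t) (at t within J))"

definition fundamental_matrix ::
  "real set \<Rightarrow> (real \<Rightarrow> real ^ 'n ^ 'n) \<Rightarrow> (real \<Rightarrow> real ^ 'n ^ 'n) \<Rightarrow> bool" where
  "fundamental_matrix J A \<Phi> \<longleftrightarrow>
     (\<forall>t\<in>J. (\<Phi> has_vector_derivative A t ** \<Phi> t) (at t within J) \<and> invertible (\<Phi> t))"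

definition transition_matrix :: "(real \<Rightarrow> real ^ 'n ^ 'n) \<Rightarrow> real \<Rightarrow> real \<Rightarrow> real ^ 'n ^ 'n" where
  "transition_matrix \<Phi> t s = \<Phi> t ** matrix_inv (\<Phi> s)"

definition growth_rate :: "real set \<Rightarrow> (real \<Rightarrow> real) \<Rightarrow> bool" where
  "growth_rate J h \<longleftrightarrow> strict_mono_on J h \<and> homeomorphism J {0<..} h (inv_into J h)"

definition star :: "real set \<Rightarrow> (real \<Rightarrow> real) \<Rightarrow> real \<Rightarrow> real \<Rightarrow> real" where
  "star J h t s = inv_into J h (h t * h s)"

definition star_unit :: "real set \<Rightarrow> (real \<Rightarrow> real) \<Rightarrow> real" where
  "star_unit J h = inv_into J h 1"

definition star_inv :: "real set \<Rightarrow> (real \<Rightarrow> real) \<Rightarrow> real \<Rightarrow> real" where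
  "star_inv J h t = inv_into J h (1 / h t)"

definition star_abs :: "real set \<Rightarrow> (real \<Rightarrow> real) \<Rightarrow> real \<Rightarrow> real" where
  "star_abs J h t = (if star_unit J h \<le> t then t else star_inv J h t)"

text \<open>In the following, \<open>I \<subseteq> J\<close> is the interval on which the property is required.\<close>

definition uniform_h_dichotomy ::
  "real set \<Rightarrow> (real \<Rightarrow> real) \<Rightarrow> (real ^ 'n \<Rightarrow> real) \<Rightarrow> (real \<Rightarrow> real ^ 'n ^ 'n) \<Rightarrow> real set \<Rightarrow> bool" where
  "uniform_h_dichotomy J h N \<Phi> I \<longleftrightarrow>
     (\<exists>P :: real \<Rightarrow> real ^ 'n ^ 'n. \<exists>K \<alpha>. K \<ge> 1 \<and> \<alpha> > 0 \<and>
        (\<forall>t\<in>J. P t ** P t = P t) \<and>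
        (\<forall>t\<in>J. \<forall>s\<in>J. P t ** transition_matrix \<Phi> t s = transition_matrix \<Phi> t s ** P s) \<and>
        (\<forall>t\<in>I. \<forall>s\<in>I. t \<ge> s \<longrightarrow>
           induced_norm N (transition_matrix \<Phi> t s ** P s) \<le> K * (h t / h s) powr (- \<alpha>)) \<and>
        (\<forall>t\<in>I. \<forall>s\<in>I. s \<ge> t \<longrightarrow>
           induced_norm N (transition_matrix \<Phi> t s ** (mat 1 - P s)) \<le> K * (h s / h t) powr (- \<alpha>)))"

definition uniform_bounded_h_growth ::
  "real set \<Rightarrow> (real \<Rightarrow> real) \<Rightarrow> (real ^ 'n \<Rightarrow> real) \<Rightarrow> (real \<Rightarrow> real ^ 'n ^ 'n) \<Rightarrow> real set \<Rightarrow> bool" where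
  "uniform_bounded_h_growth J h N A I \<longleftrightarrow>
     (\<exists>T > star_unit J h. \<exists>C \<ge> 1. \<forall>x. solution J A x \<longrightarrow>
        (\<forall>s\<in>I. \<forall>t \<in> {s..star J h s T} \<inter> I. N (x t) \<le> C * N (x s)))"

definition h_expansive ::
  "real set \<Rightarrow> (real \<Rightarrow> real) \<Rightarrow> (real ^ 'n \<Rightarrow> real) \<Rightarrow> (real \<Rightarrow> real ^ 'n ^ 'n) \<Rightarrow> real set \<Rightarrow> bool" where
  "h_expansive J h N A I \<longleftrightarrow>
     (\<exists>L > 0. \<exists>\<beta> > 0. \<forall>x. solution J A x \<longrightarrow>
        (\<forall>a b. {a..b} \<subseteq> I \<longrightarrow> (\<forall>t\<in>{a..b}.
           N (x t) \<le> L * (h (star J h t (star_inv J h a)) powr (- \<beta>) * N (x a)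
                        + h (star J h b (star_inv J h t)) powr (- \<beta>) * N (x b)))))"

text \<open>For \<open>t \<ge> T\<close> the supremum ranges over the compact interval from \<open>t * T\<^sup>-\<^sup>1\<close> to \<open>t * T\<close> in
  \<open>[e, \<infinity>)\<close>, so for a solution (which is continuous) it is a genuine real supremum.\<close>

definition uniformly_h_noncritical ::
  "real set \<Rightarrow> (real \<Rightarrow> real) \<Rightarrow> (real ^ 'n \<Rightarrow> real) \<Rightarrow> (real \<Rightarrow> real ^ 'n ^ 'n) \<Rightarrow> bool" where
  "uniformly_h_noncritical J h N A \<longleftrightarrow>
     (\<exists>T > star_unit J h. \<exists>\<theta>. 0 < \<theta> \<and> \<theta> < 1 \<and> (\<forall>x. solution J A x \<longrightarrow>
        (\<forall>t \<ge> T. N (x t) \<le>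
           \<theta> * (SUP u\<in>{u\<in>J. star_abs J h (star J h u (star_inv J h t)) \<le> T}. N (x u)))))"

end

theory Submission
  imports Defs
begin

text \<open>In the new time \<open>\<tau> = ln (h t)\<close> the group operation becomes addition, and every condition only
  concerns the family of norms \<open>F \<tau> v = N (\<Phi> t *v v)\<close>, continuous in \<open>\<tau>\<close>; since \<open>h\<close> need not be
  differentiable, the differential equation itself is not transported. The implications from
  dichotomy to expansiveness to noncriticality are direct estimates. For the converse (following
  Coppel), noncriticality makes bounded orbits decay geometrically, while the running maximum of an
  orbit, once it exceeds what bounded growth allows on the first window, has to grow geometrically.
  By compactness this happens after a uniform time for all orbits starting in a complement of
  the bounded ones, which gives the unstable subspace.\<close>

section \<open>Dichotomy, expansiveness and noncriticality for a family of seminorms\<close>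

locale seminorm_family =
  fixes F :: "real \<Rightarrow> 'a::euclidean_space \<Rightarrow> real"
  assumes nonneg: "0 \<le> F t v"
    and scale: "F t (c *\<^sub>R v) = \<bar>c\<bar> * F t v"
    and triangle: "F t (v + w) \<le> F t v + F t w"
    and cont: "continuous_on {0..} (\<lambda>t. F t v)"
begin

text \<open>A single projection, acting on initial data, stands for the whole family of projectors:
  commuting with the transition matrices makes them all conjugate to one. The case
  \<open>s = t\<close> of the two estimates bounds both projections uniformly in time.\<close>

definition dichotomic :: bool where
  "dichotomic \<longleftrightarrow> (\<exists>P K \<alpha>. linear P \<and> (\<forall>v. P (P v) = P v) \<and> K \<ge> 1 \<and> \<alpha> > 0 \<and>
     (\<forall>s t v. 0 \<le> s \<longrightarrow> s \<le> t \<longrightarrow> F t (P v) \<le> K * exp (- \<alpha> * (t - s)) * F s v) \<and>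
     (\<forall>s t v. 0 \<le> t \<longrightarrow> t \<le> s \<longrightarrow> F t (v - P v) \<le> K * exp (- \<alpha> * (s - t)) * F s v))"

definition expansive :: bool where
  "expansive \<longleftrightarrow> (\<exists>L>0. \<exists>\<beta>>0. \<forall>v a b t. 0 \<le> a \<longrightarrow> a \<le> t \<longrightarrow> t \<le> b \<longrightarrow>
     F t v \<le> L * (exp (- \<beta> * (t - a)) * F a v + exp (- \<beta> * (b - t)) * F b v))"

definition noncritical :: bool where
  "noncritical \<longleftrightarrow> (\<exists>T>0. \<exists>\<theta>. 0 < \<theta> \<and> \<theta> < 1 \<and>
     (\<forall>v. \<forall>t\<ge>T. F t v \<le> \<theta> * (SUP u\<in>{t - T..t + T}. F u v)))"

definition bounded_growth :: bool where
  "bounded_growth \<longleftrightarrow> (\<exists>T>0. \<exists>C\<ge>1. \<forall>v s t. 0 \<le> s \<longrightarrow> s \<le> t \<longrightarrow> t \<le> s + T \<longrightarrow> F t v \<le> C * F s v)"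

lemma zero: "F t 0 = 0"
  using scale[of t 0 0] by simp

lemma triangle_diff: "F t v - F t w \<le> F t (v - w)"
  using triangle[of t "v - w" w] by simp

lemma minus_commute: "F t (v - w) = F t (w - v)"
  using scale[of t "-1" "w - v"] by simp

lemma attains_max:
  assumes "0 \<le> a" "a \<le> b"
  obtains u where "u \<in> {a..b}" "\<And>w. w \<in> {a..b} \<Longrightarrow> F w v \<le> F u v"
proof -
  have "continuous_on {a..b} (\<lambda>t. F t v)"
    by (rule continuous_on_subset[OF cont]) (use assms in auto)
  then have "\<exists>u\<in>{a..b}. \<forall>w\<in>{a..b}. F w v \<le> F u v"
    using assms by (intro continuous_attains_sup) auto
  then show thesis using that by blast
qed

lemma le_SUP:
  assumes "0 \<le> a" "u \<in> {a..b}"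
  shows "F u v \<le> (SUP w\<in>{a..b}. F w v)"
proof -
  obtain m where "\<And>w. w \<in> {a..b} \<Longrightarrow> F w v \<le> F m v"
    using attains_max[of a b v] assms by auto
  then show ?thesis
    using assms by (intro cSUP_upper bdd_aboveI2[of _ _ "F m v"]) auto
qed

text \<open>Expanding \<open>v\<close> in the basis, subadditivity and homogeneity leave a finite
  sum of values \<open>F t b\<close>. The bound gives continuity in \<open>v\<close>, on which the
  compactness argument for the escape time rests.\<close>

lemma norm_bound: obtains M where "0 \<le> M" "\<And>v. F t v \<le> M * norm v"
proof -
  have *: "F t v \<le> (\<Sum>b\<in>Basis. F t b) * norm v" for v
  proof -
    have sub: "finite S \<Longrightarrow> F t (sum f S) \<le> (\<Sum>i\<in>S. F t (f i))" for S and f :: "'a \<Rightarrow> 'a"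
    proof (induction S rule: finite_induct)
      case empty
      then show ?case by (simp add: zero)
    next
      case (insert x S)
      then show ?case using triangle[of t "f x" "sum f S"] by simp
    qed
    have "F t v = F t (\<Sum>b\<in>Basis. (v \<bullet> b) *\<^sub>R b)" by (simp add: euclidean_representation)
    also have "\<dots> \<le> (\<Sum>b\<in>Basis. F t ((v \<bullet> b) *\<^sub>R b))" by (rule sub) simp
    also have "\<dots> \<le> (\<Sum>b\<in>Basis. F t b * norm v)"
    proof (rule sum_mono)
      fix b :: 'a assume "b \<in> Basis"
      then show "F t ((v \<bullet> b) *\<^sub>R b) \<le> F t b * norm v"
        using mult_left_mono[OF Basis_le_norm nonneg[of t b]] by (simp add: scale mult.commute)
    qed
    finally show ?thesis by (simp add: sum_distrib_right)
  qed
  show thesis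
    by (rule that[OF _ *]) (simp add: sum_nonneg nonneg)
qed

lemma continuous_vec: "continuous_on UNIV (F t)"
proof -
  obtain M where M: "0 \<le> M" "\<And>v. F t v \<le> M * norm v" using norm_bound[of t] by blast
  have "M-lipschitz_on UNIV (F t)"
  proof (rule lipschitz_onI)
    fix v w
    show "dist (F t v) (F t w) \<le> M * dist v w"
      using triangle_diff[of t v w] triangle_diff[of t w v] M(2)[of "v - w"] minus_commute[of t v w]
      by (simp add: dist_norm abs_le_iff)
  qed (rule M)
  then show ?thesis by (rule lipschitz_on_continuous_on)
qed

section \<open>From dichotomy to expansiveness to noncriticality\<close>

lemma dichotomic_imp_expansive:
  assumes dichotomic
  shows expansive
proof -
  obtain P K \<alpha> where K: "K \<ge> 1" "\<alpha> > 0"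
    and P: "\<And>s t v. 0 \<le> s \<Longrightarrow> s \<le> t \<Longrightarrow> F t (P v) \<le> K * exp (- \<alpha> * (t - s)) * F s v"
    and Q: "\<And>s t v. 0 \<le> t \<Longrightarrow> t \<le> s \<Longrightarrow> F t (v - P v) \<le> K * exp (- \<alpha> * (s - t)) * F s v"
    using assms unfolding dichotomic_def by blast
  \<comment> \<open>The stable part \<open>P v\<close> is estimated from the left endpoint
    \<open>a\<close>, the complementary part from the right endpoint \<open>b\<close>.\<close>
  have "F t v \<le> K * (exp (- \<alpha> * (t - a)) * F a v + exp (- \<alpha> * (b - t)) * F b v)"
    if "0 \<le> a" "a \<le> t" "t \<le> b" for v a b t
    using P[of a t v] Q[of t b v] triangle[of t "P v" "v - P v"] that
    by (simp add: algebra_simps)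
  then show ?thesis
    unfolding expansive_def using K by (intro exI[of _ K] exI[of _ \<alpha>] conjI) auto
qed

lemma expansive_imp_noncritical:
  assumes expansive
  shows noncritical
proof -
  obtain L \<beta> where L: "L > 0" "\<beta> > 0"
    and E: "\<And>v a b t. 0 \<le> a \<Longrightarrow> a \<le> t \<Longrightarrow> t \<le> b \<Longrightarrow>
      F t v \<le> L * (exp (- \<beta> * (t - a)) * F a v + exp (- \<beta> * (b - t)) * F b v)"
    using assms unfolding expansive_def by blast
  \<comment> \<open>\<open>T\<close> is so large that \<open>L * exp (- \<beta> * T)\<close> is at
    most 1/4; the two endpoints of the window together then contribute at most half of the supremum.
    The absolute value and the summand 1 keep \<open>T\<close> positive for small
    \<open>L\<close>.\<close>
  define T where "T = (\<bar>ln (4 * L)\<bar> + 1) / \<beta>"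
  have T: "T > 0" using L by (simp add: T_def)
  have "4 * L = exp (ln (4 * L))" using L by simp
  also have "\<dots> \<le> exp (\<beta> * T)"
    using L abs_ge_self[of "ln (4 * L)"] by (subst exp_le_cancel_iff) (simp add: T_def)
  finally have small: "L * exp (- \<beta> * T) \<le> 1/4"
    using L by (simp add: exp_minus field_simps)
  have "F t v \<le> 1/2 * (SUP u\<in>{t - T..t + T}. F u v)" (is "_ \<le> 1/2 * ?S") if "t \<ge> T" for v t
  proof -
    have 1: "F (t - T) v \<le> ?S" "F (t + T) v \<le> ?S"
      by (rule le_SUP; use that T in simp)+
    have 2: "0 \<le> ?S" using 1 nonneg order_trans by blast
    have "F t v \<le> L * (exp (- \<beta> * T) * F (t - T) v + exp (- \<beta> * T) * F (t + T) v)"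
      using E[of "t - T" t "t + T" v] that T by simp
    also have "\<dots> = (L * exp (- \<beta> * T)) * (F (t - T) v + F (t + T) v)"
      by (simp add: algebra_simps)
    also have "\<dots> \<le> 1/4 * (F (t - T) v + F (t + T) v)"
      by (rule mult_right_mono[OF small]) (simp add: nonneg)
    also have "\<dots> \<le> 1/2 * ?S" using 1 by simp
    finally show ?thesis .
  qed
  then show ?thesis
    unfolding noncritical_def using T
    by (intro exI[of _ T] exI[of _ "1/2 :: real"] conjI) auto
qed

section \<open>Bounded growth and geometric estimates along orbits\<close>

lemma bounded_growth_window:
  assumes bounded_growth
  obtains C where "C \<ge> 1" "\<And>v s t. 0 \<le> s \<Longrightarrow> s \<le> t \<Longrightarrow> t \<le> s + d \<Longrightarrow> F t v \<le> C * F s v"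
proof -
  obtain T C where T: "T > 0" and C: "C \<ge> 1"
    and G: "\<And>v s t. 0 \<le> s \<Longrightarrow> s \<le> t \<Longrightarrow> t \<le> s + T \<Longrightarrow> F t v \<le> C * F s v"
    using assms unfolding bounded_growth_def by blast
  \<comment> \<open>Chaining \<open>n\<close> windows of length \<open>T\<close> costs the factor
    \<open>C ^ n\<close>. Any length \<open>d\<close> is covered by finitely many of them.\<close>
  have iter: "F t v \<le> C ^ n * F s v" if "0 \<le> s" "s \<le> t" "t \<le> s + real n * T" for v s t n
    using that
  proof (induction n arbitrary: t)
    case 0
    then show ?case by simp
  next
    case (Suc n)
    \<comment> \<open>The last window is split off at the right end; the maximum with
      \<open>s\<close> covers the case that less than a full window is left.\<close>
    define r where "r = max s (t - T)"
    have r: "s \<le> r" "r \<le> t" "t \<le> r + T" "r \<le> s + real n * T"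
      using Suc.prems T by (auto simp: r_def algebra_simps)
    have "F t v \<le> C * F r v" using G r Suc.prems by auto
    also have "\<dots> \<le> C * (C ^ n * F s v)"
      using Suc.IH[of r] r Suc.prems C by (intro mult_left_mono) auto
    finally show ?case by simp
  qed
  obtain n :: nat where "d / T < real n" using reals_Archimedean2 by blast
  then have n: "d \<le> real n * T" using T by (simp add: field_simps)
  show thesis
  proof (rule that[of "C ^ n"])
    show "1 \<le> C ^ n" using C by simp
    show "F t v \<le> C ^ n * F s v" if "0 \<le> s" "s \<le> t" "t \<le> s + d" for v s t
      using that n by (intro iter) auto
  qed
qed

text \<open>The candidate for the stable subspace: it becomes the range of the projection.\<close>

definition bounded_orbits :: "'a set" where
  "bounded_orbits = {v. \<exists>B. \<forall>t\<ge>0. F t v \<le> B}"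

lemma subspace_bounded_orbits: "subspace bounded_orbits"
  unfolding subspace_def bounded_orbits_def
proof (intro conjI ballI allI)
  show "0 \<in> {v. \<exists>B. \<forall>t\<ge>0. F t v \<le> B}" by (auto simp: zero)
next
  fix v w assume "v \<in> {v. \<exists>B. \<forall>t\<ge>0. F t v \<le> B}" "w \<in> {v. \<exists>B. \<forall>t\<ge>0. F t v \<le> B}"
  then obtain B C where "\<And>t. t \<ge> 0 \<Longrightarrow> F t v \<le> B" "\<And>t. t \<ge> 0 \<Longrightarrow> F t w \<le> C" by blast
  then have "\<forall>t\<ge>0. F t (v + w) \<le> B + C" using triangle by (meson add_mono order_trans)
  then show "v + w \<in> {v. \<exists>B. \<forall>t\<ge>0. F t v \<le> B}" by blast
next
  fix c v assume "v \<in> {v. \<exists>B. \<forall>t\<ge>0. F t v \<le> B}"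
  then obtain B where "\<And>t. t \<ge> 0 \<Longrightarrow> F t v \<le> B" by blast
  then have "\<forall>t\<ge>0. F t (c *\<^sub>R v) \<le> \<bar>c\<bar> * B" by (simp add: scale mult_left_mono)
  then show "c *\<^sub>R v \<in> {v. \<exists>B. \<forall>t\<ge>0. F t v \<le> B}" by blast
qed

text \<open>Two inductions. Following \<open>nc\<close> from point to point multiplies the bound
  \<open>B\<close> by \<open>\<theta>\<close> each time, unless the path enters the window after
  \<open>s\<close>, where bounded growth gives \<open>C * F s v\<close>; letting the number of steps
  tend to infinity removes \<open>B\<close>. Then every further distance \<open>T\<close> from
  \<open>s\<close> gains a factor \<open>\<theta>\<close>, since \<open>nc\<close> moves to the left
  by at most \<open>T\<close>.\<close>

lemma bounded_orbit_decay:
  assumes T: "T > 0" and \<theta>: "0 < \<theta>" "\<theta> < 1"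
    and nc: "\<And>t. t \<ge> T \<Longrightarrow> \<exists>u\<in>{t - T..t + T}. F t v \<le> \<theta> * F u v"
    and C: "C \<ge> 1" "\<And>s t. 0 \<le> s \<Longrightarrow> s \<le> t \<Longrightarrow> t \<le> s + T \<Longrightarrow> F t v \<le> C * F s v"
    and v: "v \<in> bounded_orbits"
    and st: "0 \<le> s" "s + real k * T \<le> t"
  shows "F t v \<le> \<theta> ^ k * (C * F s v)"
proof -
  obtain B where B: "\<And>t. t \<ge> 0 \<Longrightarrow> F t v \<le> B" using v by (auto simp: bounded_orbits_def)
  have B0: "0 \<le> B" using B[of 0] nonneg[of 0 v] by simp
  have step: "F t v \<le> max (C * F s v) (\<theta> ^ j * B)" if "s \<le> t" for t j
    using that
  proof (induction j arbitrary: t)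
    case 0
    then show ?case using B[of t] st by simp
  next
    case (Suc j)
    show ?case
    proof (cases "t \<le> s + T")
      case True
      then show ?thesis using C(2)[of s t] Suc.prems st by simp
    next
      case False
      then obtain u where u: "u \<in> {t - T..t + T}" "F t v \<le> \<theta> * F u v" using nc[of t] st by auto
      have "F u v \<le> max (C * F s v) (\<theta> ^ j * B)" using Suc.IH[of u] u False by simp
      then have "F t v \<le> \<theta> * max (C * F s v) (\<theta> ^ j * B)"
        using u(2) \<theta> by (meson less_imp_le mult_left_mono order_trans)
      also have "\<dots> = max (\<theta> * (C * F s v)) (\<theta> ^ Suc j * B)"
        using \<theta> by (simp add: max_mult_distrib_left mult.assoc)
      also have "\<dots> \<le> max (C * F s v) (\<theta> ^ Suc j * B)"
        using \<theta> C nonneg[of s v] by (intro max.mono mult_left_le_one_le) auto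
      finally show ?thesis .
    qed
  qed
  have bound: "F t v \<le> C * F s v" if "s \<le> t" for t
  proof -
    have "(\<lambda>j. \<theta> ^ j * B) \<longlonglongrightarrow> 0 * B"
      using \<theta> by (intro tendsto_mult_right LIMSEQ_power_zero) auto
    then have "(\<lambda>j. max (C * F s v) (\<theta> ^ j * B)) \<longlonglongrightarrow> max (C * F s v) (0 * B)"
      by (intro tendsto_max tendsto_const)
    then have "F t v \<le> max (C * F s v) (0 * B)"
      by (rule LIMSEQ_le_const) (use step[OF that] in auto)
    then show ?thesis using C nonneg[of s v] by simp
  qed
  show ?thesis using st(2)
  proof (induction k arbitrary: t)
    case 0
    then show ?case using bound by simp
  next
    case (Suc k)
    have t: "s + real k * T \<le> t - T" using Suc.prems by (simp add: algebra_simps)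
    then have "T \<le> t" using st T by (smt (verit) mult_nonneg_nonneg of_nat_0_le_iff)
    then obtain u where u: "u \<in> {t - T..t + T}" "F t v \<le> \<theta> * F u v" using nc by blast
    have "F u v \<le> \<theta> ^ k * (C * F s v)" using Suc.IH[of u] u t by simp
    then show ?case using u(2) \<theta> by (smt (verit) mult.assoc mult_left_mono power_Suc)
  qed
qed

text \<open>Let \<open>a\<close> and \<open>b\<close> be maximum points over \<open>{0..t}\<close>
  and \<open>{0..t + T}\<close>. If \<open>a > T\<close>, then \<open>nc\<close> applies at
  \<open>a\<close> and stays inside the larger interval, so the maximum at \<open>a\<close> is at
  most \<open>\<theta>\<close> times that at \<open>b\<close>. As the latter is positive,
  \<open>b\<close> lies beyond \<open>t\<close>. So from \<open>T1\<close> on, the running maximum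
  grows by the factor \<open>1 / \<theta>\<close> over each length \<open>T\<close>.\<close>

lemma unbounded_orbit_growth:
  assumes T: "T > 0" and \<theta>: "0 < \<theta>" "\<theta> < 1"
    and nc: "\<And>t. t \<ge> T \<Longrightarrow> \<exists>u\<in>{t - T..t + T}. F t v \<le> \<theta> * F u v"
    and C: "C \<ge> 1" "\<And>s t. 0 \<le> s \<Longrightarrow> s \<le> t \<Longrightarrow> t \<le> s + T \<Longrightarrow> F t v \<le> C * F s v"
    and w: "w \<in> {0..T1}" "C * F 0 v < F w v"
    and st: "T1 \<le> t" "r \<in> {0..t}" "t + real k * T \<le> s"
  shows "F r v \<le> \<theta> ^ k * (C * F s v)"
proof -
  have step: "\<exists>b\<in>{t..t + T}. F r v \<le> \<theta> * F b v" if rt: "T1 \<le> t" "r \<in> {0..t}" for r t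
  proof -
    obtain a where a: "a \<in> {0..t}" "\<And>u. u \<in> {0..t} \<Longrightarrow> F u v \<le> F a v"
      using attains_max[of 0 t v] rt by auto
    obtain b where b: "b \<in> {0..t + T}" "\<And>u. u \<in> {0..t + T} \<Longrightarrow> F u v \<le> F b v"
      using attains_max[of 0 "t + T" v] rt T by auto
    \<comment> \<open>The witness \<open>w\<close> lies in \<open>{0..t}\<close>, so the running
      maximum exceeds everything that bounded growth permits on \<open>{0..T}\<close>; hence
      \<open>a > T\<close>.\<close>
    have big: "C * F 0 v < F a v" using a(2)[of w] w rt by simp
    then have "a > T" using C(2)[of 0 a] a(1) by fastforce
    then obtain u where u: "u \<in> {a - T..a + T}" "F a v \<le> \<theta> * F u v" using nc[of a] by auto
    have "F u v \<le> F b v" using b(2)[of u] u a(1) \<open>a > T\<close> by simp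
    then have ab: "F a v \<le> \<theta> * F b v" using u(2) \<theta> by (smt (verit) mult_left_mono)
    have "0 \<le> C * F 0 v" using C nonneg by simp
    then have "0 < \<theta> * F b v" using big ab by linarith
    then have "0 < F b v" using \<theta> by (simp add: zero_less_mult_iff)
    then have "\<theta> * F b v < F b v" using \<theta> by simp
    then have "b > t" using a(2)[of b] b(1) ab by force
    then show ?thesis using ab a(2)[OF rt(2)] b(1) by (intro bexI[of _ b]) auto
  qed
  show ?thesis using st
  proof (induction k arbitrary: t r)
    case 0
    \<comment> \<open>At the end the maximum is attained within one window after \<open>s\<close>,
      and bounded growth compares it with the value at \<open>s\<close> itself. This is where the
      factor \<open>C\<close> comes from.\<close>
    then obtain b where b: "b \<in> {s..s + T}" "F r v \<le> \<theta> * F b v" using step[of s r] by auto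
    have "\<theta> * F b v \<le> F b v" using \<theta> nonneg[of b v] by (intro mult_left_le_one_le) auto
    also have "\<dots> \<le> C * F s v" using C(2)[of s b] b 0 by auto
    finally show ?case using b by simp
  next
    case (Suc k)
    then obtain b where b: "b \<in> {t..t + T}" "F r v \<le> \<theta> * F b v" using step[of t r] by auto
    have "F b v \<le> \<theta> ^ k * (C * F s v)"
      using Suc.IH[of "t + T" b] b Suc.prems T by (simp add: algebra_simps)
    then show ?case using b(2) \<theta> by (smt (verit) mult.assoc mult_left_mono power_Suc)
  qed
qed

text \<open>Otherwise there are unit vectors of \<open>W\<close> that stay below \<open>C\<close>
  times their initial value on longer and longer intervals. A limit point of them is a unit vector
  of \<open>W\<close> with a bounded orbit, which is excluded.\<close>

lemma uniform_escape_time: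
  assumes W: "subspace W" and unb: "\<And>v. v \<in> W \<Longrightarrow> v \<noteq> 0 \<Longrightarrow> v \<notin> bounded_orbits"
    and C: "C \<ge> 0"
  obtains T1 where "T1 \<ge> 0" "\<And>v. v \<in> W \<Longrightarrow> v \<noteq> 0 \<Longrightarrow> \<exists>u\<in>{0..T1}. C * F 0 v < F u v"
proof -
  have "\<exists>n::nat. \<forall>v\<in>W. v \<noteq> 0 \<longrightarrow> (\<exists>u\<in>{0..real n}. C * F 0 v < F u v)"
  proof (rule ccontr)
    assume "\<not> ?thesis"
    then have "\<forall>n::nat. \<exists>v. v \<in> W \<and> v \<noteq> 0 \<and> (\<forall>u\<in>{0..real n}. F u v \<le> C * F 0 v)"
      by (meson not_le)
    then obtain f where f: "\<And>n::nat. f n \<in> W" "\<And>n. f n \<noteq> 0"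
      "\<And>n u. u \<in> {0..real n} \<Longrightarrow> F u (f n) \<le> C * F 0 (f n)" by metis
    \<comment> \<open>Both sides of the failing inequality are homogeneous, so it survives
      normalisation; on unit vectors \<open>F 0\<close> is at most \<open>M\<close>, which makes the
      bound \<open>C * M\<close> independent of \<open>n\<close>.\<close>
    define g where "g n = (1 / norm (f n)) *\<^sub>R f n" for n
    have g: "g n \<in> sphere 0 1 \<inter> W" for n
      using f(1,2)[of n] W by (auto simp: g_def subspace_scale)
    obtain M where M: "0 \<le> M" "\<And>v. F 0 v \<le> M * norm v" using norm_bound[of 0] by blast
    have gb: "F u (g n) \<le> C * M" if "u \<in> {0..real n}" for u n
    proof -
      have "F u (g n) \<le> C * F 0 (g n)"
        using mult_left_mono[OF f(3)[OF that], of "1 / norm (f n)"] by (simp add: g_def scale)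
      also have "\<dots> \<le> C * M"
        using M(2)[of "g n"] g[of n] C by (intro mult_left_mono) auto
      finally show ?thesis .
    qed
    have "compact (sphere 0 1 \<inter> W)" using closed_subspace[OF W] by (simp add: compact_Int_closed)
    then obtain l r where l: "l \<in> sphere 0 1 \<inter> W" and r: "strict_mono r" "(g \<circ> r) \<longlonglongrightarrow> l"
      using g by (metis (no_types, lifting) compact_imp_seq_compact seq_compactE)
    have "F u l \<le> C * M" if "u \<ge> 0" for u
    proof (rule LIMSEQ_le_const2)
      have "isCont (F u) l" using continuous_vec[of u] by (simp add: continuous_on_eq_continuous_at)
      then show "(\<lambda>n. F u (g (r n))) \<longlonglongrightarrow> F u l"
        using isCont_tendsto_compose r(2) by (force simp: o_def)
      obtain N where "u < real N" using reals_Archimedean2 by blast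
      then have "F u (g (r n)) \<le> C * M" if "n \<ge> N" for n
        using seq_suble[OF r(1), of n] that \<open>u \<ge> 0\<close> by (intro gb) auto
      then show "\<exists>N. \<forall>n\<ge>N. F u (g (r n)) \<le> C * M" by blast
    qed
    then have "l \<in> bounded_orbits" by (auto simp: bounded_orbits_def)
    moreover have "l \<noteq> 0" using l by auto
    ultimately show False using unb l by blast
  qed
  then obtain n :: nat where "\<forall>v\<in>W. v \<noteq> 0 \<longrightarrow> (\<exists>u\<in>{0..real n}. C * F 0 v < F u v)" by blast
  then show thesis using that[of "real n"] by auto
qed

end

text \<open>\<open>k\<close> is the integer part of \<open>d / T\<close>. Rounding down loses less
  than one step, which the factor \<open>1 / \<theta>\<close> pays for.\<close>

lemma geometric_le_exponential:
  fixes T \<theta> d :: real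
  assumes "T > 0" "0 < \<theta>" "\<theta> < 1" "d \<ge> 0"
  obtains k :: nat where "real k * T \<le> d" "\<theta> ^ k \<le> exp (- (ln (1 / \<theta>) / T) * d) / \<theta>"
proof -
  define k where "k = nat \<lfloor>d / T\<rfloor>"
  have nn: "d / T \<ge> 0" using assms by simp
  have k: "real k \<le> d / T" "d / T \<le> real k + 1"
    using nn unfolding k_def by linarith+
  have "\<theta> ^ Suc k = exp (ln \<theta> * (real k + 1))"
    using assms exp_of_nat2_mult[of "ln \<theta>" "Suc k"] by (simp add: add.commute)
  also have "\<dots> \<le> exp (ln \<theta> * (d / T))"
    by (subst exp_le_cancel_iff, rule mult_left_mono_neg) (use k assms in auto)
  also have "ln \<theta> * (d / T) = - (ln (1 / \<theta>) / T) * d" using assms by (simp add: ln_div)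
  finally have "\<theta> ^ k \<le> exp (- (ln (1 / \<theta>) / T) * d) / \<theta>" using assms by (simp add: field_simps)
  then show thesis using that k assms by (simp add: field_simps)
qed

section \<open>From noncriticality and bounded growth to dichotomy\<close>

context seminorm_family
begin

text \<open>The bound on the projection: if the unstable part of \<open>v\<close> is at least comparable with the
  stable one, then after a fixed time it dominates it by so much that \<open>F\<close> at the later time, and
  hence by bounded growth at the present time, controls the stable part.\<close>

lemma stable_part_bounded:
  assumes growth: bounded_growth and K: "K \<ge> 1" and \<alpha>: "\<alpha> > 0"
    and P: "\<And>s t v. 0 \<le> s \<Longrightarrow> s \<le> t \<Longrightarrow> F t (P v) \<le> K * exp (- \<alpha> * (t - s)) * F s (P v)"
    and Q: "\<And>s t v. 0 \<le> t \<Longrightarrow> t \<le> s \<Longrightarrow> F t (v - P v) \<le> K * exp (- \<alpha> * (s - t)) * F s (v - P v)"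
  obtains M where "M \<ge> 1" "\<And>s v. s \<ge> 0 \<Longrightarrow> F s (P v) \<le> M * F s v"
proof -
  \<comment> \<open>After time \<open>\<tau>\<close> the unstable part has grown at least by
    \<open>2 * (1 + K)\<close>. The 2 makes up for the threshold of the case distinction below; of
    the remaining \<open>(1 + K) * F s (P v)\<close>, the stable part at time
    \<open>s + \<tau>\<close> consumes at most \<open>K * F s (P v)\<close>.\<close>
  define \<tau> where "\<tau> = ln (2 * K * (1 + K)) / \<alpha>"
  have "2 * K * (1 + K) \<ge> 2 * 1 * (1 + 1)" using K by (intro mult_mono) auto
  then have K4: "2 * K * (1 + K) \<ge> 4" by simp
  then have \<tau>: "\<tau> \<ge> 0" using \<alpha> by (simp add: \<tau>_def)
  have e\<tau>: "exp (\<alpha> * \<tau>) = 2 * K * (1 + K)" using \<alpha> K4 by (simp add: \<tau>_def)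
  obtain C where C: "C \<ge> 1" "\<And>v s t. 0 \<le> s \<Longrightarrow> s \<le> t \<Longrightarrow> t \<le> s + \<tau> \<Longrightarrow> F t v \<le> C * F s v"
    using bounded_growth_window[OF growth, of \<tau>] by metis
  have "F s (P v) \<le> max 2 C * F s v" if "s \<ge> 0" for s v
  proof (cases "F s (P v) \<ge> 2 * F s (v - P v)")
    case True
    have "F s (P v) \<le> F s v + F s (v - P v)"
      using triangle_diff[of s "P v" v] minus_commute[of s v "P v"] by simp
    then have "F s (P v) \<le> 2 * F s v" using True by simp
    also have "\<dots> \<le> max 2 C * F s v" by (intro mult_right_mono nonneg) auto
    finally show ?thesis .
  next
    case False
    have "F s (v - P v) \<le> K * exp (- \<alpha> * \<tau>) * F (s + \<tau>) (v - P v)"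
      using Q[of s "s + \<tau>" v] that \<tau> by simp
    also have "K * exp (- \<alpha> * \<tau>) = 1 / (2 * (1 + K))"
      using K e\<tau> by (simp add: exp_minus divide_simps)
    finally have "2 * (1 + K) * F s (v - P v) \<le> F (s + \<tau>) (v - P v)"
      using K by (simp add: field_simps)
    moreover have "(1 + K) * F s (P v) \<le> (1 + K) * (2 * F s (v - P v))"
      using False K by (intro mult_left_mono) auto
    ultimately have 1: "(1 + K) * F s (P v) \<le> F (s + \<tau>) (v - P v)" by (simp add: algebra_simps)
    have "F (s + \<tau>) (P v) \<le> K * exp (- \<alpha> * \<tau>) * F s (P v)"
      using P[of s "s + \<tau>" v] that \<tau> by simp
    also have "\<dots> \<le> K * 1 * F s (P v)"
      using K \<alpha> \<tau> by (intro mult_right_mono mult_left_mono nonneg) auto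
    finally have "F s (P v) \<le> F (s + \<tau>) (v - P v) - F (s + \<tau>) (P v)"
      using 1 by (simp add: algebra_simps)
    also have "\<dots> \<le> F (s + \<tau>) v"
      using triangle[of "s + \<tau>" v "- P v"] scale[of "s + \<tau>" "-1" "P v"] by simp
    also have "\<dots> \<le> C * F s v" using C(2)[of s "s + \<tau>" v] that \<tau> by simp
    also have "\<dots> \<le> max 2 C * F s v" by (intro mult_right_mono nonneg) auto
    finally show ?thesis .
  qed
  then show thesis using that[of "max 2 C"] by simp
qed

lemma noncritical_imp_dichotomic:
  assumes growth: bounded_growth and noncritical
  shows dichotomic
proof -
  obtain T \<theta> where T: "T > 0" and \<theta>: "0 < \<theta>" "\<theta> < 1"
    and nc0: "\<And>v t. t \<ge> T \<Longrightarrow> F t v \<le> \<theta> * (SUP u\<in>{t - T..t + T}. F u v)"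
    using \<open>noncritical\<close> unfolding noncritical_def by blast
  \<comment> \<open>The supremum is attained, which turns noncriticality into a step from
    \<open>t\<close> to a definite point \<open>u\<close>.\<close>
  have nc: "\<exists>u\<in>{t - T..t + T}. F t v \<le> \<theta> * F u v" if "t \<ge> T" for v t
  proof -
    obtain u where u: "u \<in> {t - T..t + T}" "\<And>w. w \<in> {t - T..t + T} \<Longrightarrow> F w v \<le> F u v"
      using attains_max[of "t - T" "t + T" v] T \<open>t \<ge> T\<close> by auto
    have "(SUP u\<in>{t - T..t + T}. F u v) \<le> F u v"
      using u by (intro cSUP_least) auto
    then have "\<theta> * (SUP u\<in>{t - T..t + T}. F u v) \<le> \<theta> * F u v" using \<theta> by simp
    then show ?thesis using nc0[OF that, of v] u(1) order_trans by blast
  qed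
  obtain C where C: "C \<ge> 1" "\<And>v s t. 0 \<le> s \<Longrightarrow> s \<le> t \<Longrightarrow> t \<le> s + T \<Longrightarrow> F t v \<le> C * F s v"
    using bounded_growth_window[OF growth, of T] by metis
  \<comment> \<open>A left inverse of the identity on the subspace of bounded orbits is a linear
    projection onto it.\<close>
  obtain P where P: "range P \<subseteq> bounded_orbits" "linear P" "\<And>v. v \<in> bounded_orbits \<Longrightarrow> P v = v"
    using linear_exists_left_inverse_on[OF linear_id subspace_bounded_orbits] by auto
  interpret P: linear P by (rule P)
  have PP: "P (P v) = P v" for v using P by blast
  \<comment> \<open>The kernel of \<open>P\<close> serves as unstable subspace: a bounded orbit in
    it is fixed by \<open>P\<close> and hence zero.\<close>
  define W where "W = {v. P v = 0}"
  have W: "subspace W" unfolding W_def using linear_subspace_kernel[OF P(2)] by simp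
  have "v \<notin> bounded_orbits" if "v \<in> W" "v \<noteq> 0" for v
    using that P(3) by (auto simp: W_def)
  then obtain T1 where T1: "T1 \<ge> 0" "\<And>v. v \<in> W \<Longrightarrow> v \<noteq> 0 \<Longrightarrow> \<exists>u\<in>{0..T1}. C * F 0 v < F u v"
    using uniform_escape_time[OF W, of C] C by auto
  obtain C1 where C1: "C1 \<ge> 1" "\<And>v s t. 0 \<le> s \<Longrightarrow> s \<le> t \<Longrightarrow> t \<le> s + T1 \<Longrightarrow> F t v \<le> C1 * F s v"
    using bounded_growth_window[OF growth, of T1] by metis
  define \<alpha> where "\<alpha> = ln (1 / \<theta>) / T"
  \<comment> \<open>\<open>C\<close> comes from the geometric estimates, \<open>C1\<close> from
    waiting for the escape time \<open>T1\<close>, and \<open>1 / \<theta>\<close> from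
    rounding.\<close>
  define K where "K = C * C1 / \<theta>"
  have \<alpha>: "\<alpha> > 0" using \<theta> T by (simp add: \<alpha>_def)
  have "1 * 1 \<le> C * C1" using C C1 by (intro mult_mono) auto
  then have K: "K \<ge> 1" using \<theta> by (simp add: K_def field_simps)
  have stable: "F t (P v) \<le> K * exp (- \<alpha> * (t - s)) * F s (P v)" if st: "0 \<le> s" "s \<le> t" for s t v
  proof -
    obtain k where k: "real k * T \<le> t - s" "\<theta> ^ k \<le> exp (- \<alpha> * (t - s)) / \<theta>"
      using geometric_le_exponential[OF T \<theta>, of "t - s", folded \<alpha>_def] st by auto
    have "F t (P v) \<le> \<theta> ^ k * (C * F s (P v))"
      using P(1) k st by (intro bounded_orbit_decay[OF T \<theta> nc C]) auto
    also have "\<dots> \<le> exp (- \<alpha> * (t - s)) / \<theta> * (C * F s (P v))"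
      using k C nonneg by (intro mult_right_mono) auto
    also have "\<dots> \<le> exp (- \<alpha> * (t - s)) / \<theta> * (C * C1 * F s (P v))"
      using C C1 \<theta> nonneg by (intro mult_left_mono mult_right_mono) auto
    finally show ?thesis by (simp add: K_def algebra_simps)
  qed
  have unstable: "F t (v - P v) \<le> K * exp (- \<alpha> * (s - t)) * F s (v - P v)" if st: "0 \<le> t" "t \<le> s" for s t v
  proof (cases "v - P v = 0")
    case True
    then show ?thesis by (simp add: zero)
  next
    case False
    obtain k where k: "real k * T \<le> s - t" "\<theta> ^ k \<le> exp (- \<alpha> * (s - t)) / \<theta>"
      using geometric_le_exponential[OF T \<theta>, of "s - t", folded \<alpha>_def] st by auto
    have "v - P v \<in> W" by (simp add: W_def P.diff PP)
    then obtain u where u: "u \<in> {0..T1}" "C * F 0 (v - P v) < F u (v - P v)" using T1 False by blast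
    \<comment> \<open>Growth is guaranteed only from \<open>T1\<close> on, so it is counted from
      \<open>t + T1\<close> to \<open>s + T1\<close>, a stretch of the same length; bounded growth
      over \<open>T1\<close> then leads back to \<open>s\<close>.\<close>
    have "F t (v - P v) \<le> \<theta> ^ k * (C * F (s + T1) (v - P v))"
      by (rule unbounded_orbit_growth[OF T \<theta> nc C u, of "t + T1"]) (use st k T1 in auto)
    also have "\<dots> \<le> exp (- \<alpha> * (s - t)) / \<theta> * (C * F (s + T1) (v - P v))"
      using k C nonneg by (intro mult_right_mono) auto
    also have "\<dots> \<le> exp (- \<alpha> * (s - t)) / \<theta> * (C * (C1 * F s (v - P v)))"
      using C C1(2)[of s "s + T1" "v - P v"] T1 st \<theta> by (intro mult_left_mono) auto
    finally show ?thesis by (simp add: K_def algebra_simps)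
  qed
  \<comment> \<open>So far each part is compared with its own earlier or later value. Boundedness of
    the projections, with \<open>M + 1\<close> for both, replaces this value by that of
    \<open>v\<close>.\<close>
  obtain M where M: "M \<ge> 1" "\<And>s v. s \<ge> 0 \<Longrightarrow> F s (P v) \<le> M * F s v"
    using stable_part_bounded[OF growth K \<alpha> stable unstable] by metis
  have M': "F s (v - P v) \<le> (M + 1) * F s v" if "s \<ge> 0" for s v
    using M(2)[OF that, of v] triangle[of s v "- P v"] scale[of s "-1" "P v"]
    by (simp add: algebra_simps)
  have "F t (P v) \<le> K * (M + 1) * exp (- \<alpha> * (t - s)) * F s v" if "0 \<le> s" "s \<le> t" for s t v
  proof -
    have "F s (P v) \<le> (M + 1) * F s v" using M(2)[OF that(1), of v] nonneg[of s v] by (simp add: algebra_simps)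
    then have "K * exp (- \<alpha> * (t - s)) * F s (P v) \<le> K * exp (- \<alpha> * (t - s)) * ((M + 1) * F s v)"
      using K by (intro mult_left_mono) auto
    then show ?thesis using stable[OF that, of v] by (simp add: mult_ac)
  qed
  moreover have "F t (v - P v) \<le> K * (M + 1) * exp (- \<alpha> * (s - t)) * F s v" if "0 \<le> t" "t \<le> s" for s t v
  proof -
    have "K * exp (- \<alpha> * (s - t)) * F s (v - P v) \<le> K * exp (- \<alpha> * (s - t)) * ((M + 1) * F s v)"
      using K M'[of s v] that by (intro mult_left_mono) auto
    then show ?thesis using unstable[OF that, of v] by (simp add: mult_ac)
  qed
  moreover have "K * (M + 1) \<ge> 1 * 1" using K M by (intro mult_mono) auto
  ultimately show ?thesis
    unfolding dichotomic_def using P(2) PP \<alpha>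
    by (intro exI[of _ P] exI[of _ "K * (M + 1)"] exI[of _ \<alpha>] conjI) auto
qed

end

section \<open>Linear systems: the fundamental matrix yields all solutions\<close>

lemma bounded_bilinear_matrix_vector_mult:
  "bounded_bilinear ((*v) :: real ^ 'n ^ 'm \<Rightarrow> real ^ 'n \<Rightarrow> real ^ 'm)"
  unfolding bilinear_conv_bounded_bilinear[symmetric] bilinear_def
  by (auto intro!: linearI simp: matrix_vector_mult_add_rdistrib matrix_vector_right_distrib
      scaleR_matrix_vector_assoc matrix_vector_mult_scaleR)

lemma invertible_matrix_inv:
  fixes M :: "real ^ 'n ^ 'n"
  assumes "invertible M"
  shows "M ** matrix_inv M = mat 1" "matrix_inv M ** M = mat 1"
  using someI_ex[OF assms[unfolded invertible_def]] by (auto simp: matrix_inv_def)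

locale linear_system =
  fixes J :: "real set"
    and A \<Phi> :: "real \<Rightarrow> real ^ 'n ^ 'n"
    and N :: "real ^ 'n \<Rightarrow> real"
    and h :: "real \<Rightarrow> real"
  assumes domain: "admissible_domain J"
    and fundamental: "fundamental_matrix J A \<Phi>"
    and norm_N: "vector_norm N"
    and growth_h: "growth_rate J h"
begin

lemma \<Phi>_deriv: "t \<in> J \<Longrightarrow> (\<Phi> has_vector_derivative A t ** \<Phi> t) (at t within J)"
  and \<Phi>_invertible: "t \<in> J \<Longrightarrow> invertible (\<Phi> t)"
  using fundamental by (auto simp: fundamental_matrix_def)

lemma \<Phi>_inv_mult [simp]:
  assumes "t \<in> J"
  shows "matrix_inv (\<Phi> t) *v (\<Phi> t *v v) = v" "\<Phi> t *v (matrix_inv (\<Phi> t) *v v) = v"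
  using invertible_matrix_inv[OF \<Phi>_invertible[OF assms]]
  by (simp_all add: matrix_vector_mul_assoc)

lemma solution_\<Phi>: "solution J A (\<lambda>t. \<Phi> t *v v)"
  unfolding solution_def
proof
  fix t assume "t \<in> J"
  then show "((\<lambda>t. \<Phi> t *v v) has_vector_derivative A t *v (\<Phi> t *v v)) (at t within J)"
    using bounded_bilinear.has_vector_derivative[OF bounded_bilinear_matrix_vector_mult \<Phi>_deriv
        has_vector_derivative_const[of v]]
    by (simp add: matrix_vector_mul_assoc)
qed

text \<open>The inverse of \<open>\<Phi> t\<close> gives the lower bound \<open>1 / R\<close> at
  \<open>t\<close> itself. Continuity keeps half of it nearby: the tolerance
  \<open>1 / (2 * R * K)\<close> is chosen so that the perturbation costs at most
  \<open>norm w / (2 * R)\<close>.\<close>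

lemma \<Phi>_bounded_below:
  assumes t: "t \<in> J"
  obtains m d where "m > 0" "d > 0"
    "\<And>u w. u \<in> J \<Longrightarrow> \<bar>u - t\<bar> < d \<Longrightarrow> m * norm w \<le> norm (\<Phi> u *v w)"
proof -
  obtain K where K: "K > 0" "\<And>M w. norm ((M :: real ^ 'n ^ 'n) *v w) \<le> norm M * norm w * K"
    using bounded_bilinear.pos_bounded[OF bounded_bilinear_matrix_vector_mult] by blast
  define R where "R = norm (matrix_inv (\<Phi> t)) * K + 1"
  have R: "R > 0" using K by (auto simp: R_def intro!: add_nonneg_pos)
  have Rw: "norm w \<le> R * norm (\<Phi> t *v w)" for w
  proof -
    have "norm w \<le> norm (matrix_inv (\<Phi> t)) * norm (\<Phi> t *v w) * K"
      using K(2)[of "matrix_inv (\<Phi> t)" "\<Phi> t *v w"] t by simp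
    also have "\<dots> \<le> R * norm (\<Phi> t *v w)" by (simp add: R_def algebra_simps)
    finally show ?thesis .
  qed
  have "continuous (at t within J) \<Phi>"
    using \<Phi>_deriv[OF t] by (rule has_vector_derivative_continuous)
  then obtain d where d: "d > 0" "\<And>u. u \<in> J \<Longrightarrow> \<bar>u - t\<bar> < d \<Longrightarrow> norm (\<Phi> u - \<Phi> t) < 1 / (2 * R * K)"
    unfolding continuous_within_eps_delta dist_norm real_norm_def using R K
    by (metis mult_pos_pos zero_less_divide_1_iff zero_less_numeral)
  have "1 / (2 * R) * norm w \<le> norm (\<Phi> u *v w)" if "u \<in> J" "\<bar>u - t\<bar> < d" for u w
  proof -
    have "norm ((\<Phi> u - \<Phi> t) *v w) \<le> norm (\<Phi> u - \<Phi> t) * norm w * K" by (rule K)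
    also have "\<dots> \<le> 1 / (2 * R * K) * norm w * K"
      using d(2)[OF that] K by (intro mult_right_mono) auto
    also have "\<dots> = norm w / (2 * R)" using K by simp
    finally have 1: "norm (\<Phi> u *v w - \<Phi> t *v w) \<le> norm w / (2 * R)"
      by (simp add: matrix_vector_mult_diff_rdistrib)
    have "norm w / R \<le> norm (\<Phi> t *v w)" using Rw[of w] R by (simp add: field_simps)
    then have "norm w / R - norm w / (2 * R) \<le> norm (\<Phi> u *v w)"
      using 1 norm_triangle_ineq2[of "\<Phi> t *v w" "\<Phi> t *v w - \<Phi> u *v w"]
      by (simp add: norm_minus_commute)
    then show ?thesis using R by (simp add: field_simps)
  qed
  then show thesis using that[of "1 / (2 * R)" d] R d by simp
qed

text \<open>With \<open>c = \<Phi>\<^sup>-\<^sup>1 x\<close>, the solution \<open>x - \<Phi> c(t)\<close> vanishes at \<open>t\<close> together with its derivative,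
  and \<open>\<Phi> (c - c(t))\<close> is equal to it; since \<open>\<Phi>\<close> is bounded below near \<open>t\<close>, \<open>c\<close> has derivative 0.
  This avoids differentiating the inverse of \<open>\<Phi>\<close>.\<close>

lemma solution_imp_\<Phi>:
  assumes x: "solution J A x"
  obtains v where "\<And>t. t \<in> J \<Longrightarrow> x t = \<Phi> t *v v"
proof -
  define c where "c t = matrix_inv (\<Phi> t) *v x t" for t
  have xc: "x t = \<Phi> t *v c t" if "t \<in> J" for t using that by (simp add: c_def)
  have "convex J" using domain by (auto simp: admissible_domain_def)
  moreover have "(c has_derivative (\<lambda>_. 0)) (at t within J)" if t: "t \<in> J" for t
    unfolding has_derivative_within_alt
  proof (intro conjI allI impI)
    fix e :: real assume e: "e > 0"
    obtain m d1 where m: "m > 0" "d1 > 0"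
      "\<And>u w. u \<in> J \<Longrightarrow> \<bar>u - t\<bar> < d1 \<Longrightarrow> m * norm w \<le> norm (\<Phi> u *v w)"
      using \<Phi>_bounded_below[OF t] by blast
    have "((\<lambda>u. x u - \<Phi> u *v c t) has_vector_derivative A t *v x t - A t *v (\<Phi> t *v c t)) (at t within J)"
      using x solution_\<Phi>[of "c t"] t unfolding solution_def by (intro has_vector_derivative_diff) auto
    then have "((\<lambda>u. x u - \<Phi> u *v c t) has_derivative (\<lambda>_. 0)) (at t within J)"
      using xc[OF t] by (simp add: has_vector_derivative_def)
    \<comment> \<open>The tolerance \<open>e * m\<close> becomes \<open>e\<close> once the lower
      bound \<open>m\<close> of \<open>\<Phi>\<close> is divided out.\<close>
    then obtain d2 where d2: "d2 > 0"
      "\<And>u. u \<in> J \<Longrightarrow> \<bar>u - t\<bar> < d2 \<Longrightarrow> norm (x u - \<Phi> u *v c t) \<le> (e * m) * \<bar>u - t\<bar>"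
      unfolding has_derivative_within_alt using xc[OF t] e m(1) by (force dest: spec[of _ "e * m"])
    show "\<exists>d>0. \<forall>u\<in>J. norm (u - t) < d \<longrightarrow> norm (c u - c t - 0) \<le> e * norm (u - t)"
    proof (intro exI[of _ "min d1 d2"] conjI ballI impI)
      fix u assume u: "u \<in> J" "norm (u - t) < min d1 d2"
      have "m * norm (c u - c t) \<le> norm (\<Phi> u *v (c u - c t))" using m(3) u by simp
      also have "\<dots> = norm (x u - \<Phi> u *v c t)"
        using xc[OF u(1)] by (simp add: matrix_vector_mult_diff_distrib)
      also have "\<dots> \<le> (e * m) * \<bar>u - t\<bar>" using d2(2) u by simp
      finally show "norm (c u - c t - 0) \<le> e * norm (u - t)" using m(1) by (simp add: mult_ac)
    qed (use m d2 in auto)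
  qed simp
  ultimately obtain v where "\<forall>t\<in>J. c t = v"
    using has_derivative_zero_constant[of J c] by blast
  then show thesis using that[of v] xc by simp
qed

section \<open>Logarithmic time: \<open>g\<close> as order isomorphism from the additive reals to
  \<open>J\<close> with \<open>star\<close>\<close>

definition g :: "real \<Rightarrow> real" where "g \<tau> = inv_into J h (exp \<tau>)"

lemma homeo: "homeomorphism J {0<..} h (inv_into J h)" and mono_h: "strict_mono_on J h"
  using growth_h by (auto simp: growth_rate_def)

lemma h_g [simp]: "h (g \<tau>) = exp \<tau>"
  using homeo by (auto simp: homeomorphism_def g_def)

lemma h_ratio_powr: "(h (g a) / h (g b)) powr (- \<alpha>) = exp (- \<alpha> * (a - b))"
  by (simp add: exp_diff[symmetric] exp_powr_real mult.commute)

lemma g_in_J [simp]: "g \<tau> \<in> J"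
  using homeo unfolding homeomorphism_def g_def by (metis exp_gt_zero greaterThan_iff imageI)

lemma g_ln_h: assumes "t \<in> J" shows "g (ln (h t)) = t"
proof -
  have "h t > 0" using assms homeo unfolding homeomorphism_def by (metis greaterThan_iff imageI)
  then show ?thesis using assms homeo by (simp add: g_def homeomorphism_def)
qed

lemma g_le_iff [simp]: "g a \<le> g b \<longleftrightarrow> a \<le> b"
  using strict_mono_on_less_eq[OF mono_h, of "g a" "g b"] by simp

lemma g_less_iff [simp]: "g a < g b \<longleftrightarrow> a < b"
  by (simp add: less_le_not_le)

lemma J_upward: "a \<in> J \<Longrightarrow> a \<le> b \<Longrightarrow> b \<in> J"
  using domain by (auto simp: admissible_domain_def)

text \<open>The half line above \<open>star_unit J h\<close> is not intersected with
  \<open>J\<close>. Since \<open>J\<close> is closed upwards, all its points still lie in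
  \<open>J\<close> and have a logarithmic time.\<close>

lemma above_g: assumes "g a \<le> t" obtains \<tau> where "t = g \<tau>" "a \<le> \<tau>"
  using J_upward[OF g_in_J assms] g_ln_h assms g_le_iff by metis

lemma star_g [simp]: "star J h (g a) (g b) = g (a + b)"
  by (simp add: star_def g_def[of "a + b"] exp_add)

lemma star_unit_g: "star_unit J h = g 0"
  by (simp add: star_unit_def g_def)

lemma star_inv_g [simp]: "star_inv J h (g a) = g (- a)"
  by (simp add: star_inv_def g_def[of "- a"] exp_minus inverse_eq_divide)

lemma star_abs_g [simp]: "star_abs J h (g a) = g \<bar>a\<bar>"
  by (simp add: star_abs_def star_unit_g abs_if)

lemma continuous_g: "continuous_on UNIV g"
proof -
  have "continuous_on {0<..} (inv_into J h)"
    using homeo by (simp add: homeomorphism_def)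
  moreover have "continuous_on UNIV (exp :: real \<Rightarrow> real)"
    by (rule continuous_on_exp[OF continuous_on_id])
  ultimately show ?thesis
    unfolding g_def by (rule continuous_on_compose2) auto
qed

lemma N_nonneg: "0 \<le> N x" and N_eq_0: "N x = 0 \<longleftrightarrow> x = 0"
  and N_scale: "N (c *\<^sub>R x) = \<bar>c\<bar> * N x" and N_triangle: "N (x + y) \<le> N x + N y"
  using norm_N by (auto simp: vector_norm_def)

text \<open>Viewing the norm as a constant family makes \<open>norm_bound\<close> and
  \<open>continuous_vec\<close> available for \<open>N\<close>.\<close>

sublocale N: seminorm_family "\<lambda>_. N"
  by unfold_locales (auto simp: N_nonneg N_scale N_triangle)

definition F :: "real \<Rightarrow> real ^ 'n \<Rightarrow> real" where "F \<tau> v = N (\<Phi> (g \<tau>) *v v)"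

sublocale seminorm_family F
proof
  fix v
  have "continuous_on J \<Phi>"
    by (rule continuous_on_vector_derivative) (rule \<Phi>_deriv)
  then have "continuous_on UNIV (\<lambda>t. \<Phi> (g t))"
    by (rule continuous_on_compose2) (auto intro: continuous_g)
  then have "continuous_on UNIV (\<lambda>t. \<Phi> (g t) *v v)"
    by (intro bounded_bilinear.continuous_on[OF bounded_bilinear_matrix_vector_mult] continuous_on_const)
  then have "continuous_on UNIV (\<lambda>t. F t v)"
    unfolding F_def by (rule continuous_on_compose2[OF N.continuous_vec]) auto
  then show "continuous_on {0..} (\<lambda>t. F t v)" by (rule continuous_on_subset) auto
qed (auto simp: F_def N_nonneg N_scale N_triangle matrix_vector_mult_scaleR matrix_vector_right_distrib)

section \<open>Translation of the notions to the family \<open>F\<close>\<close>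

lemma norm_le_N: obtains c where "\<And>x. norm x \<le> c * N x"
proof -
  have ne: "sphere 0 1 \<noteq> ({} :: (real ^ 'n) set)" by simp
  have "continuous_on (sphere 0 1) N" using N.continuous_vec by (rule continuous_on_subset) auto
  then obtain w where w: "w \<in> sphere 0 1" "\<And>y. y \<in> sphere 0 1 \<Longrightarrow> N w \<le> N y"
    using continuous_attains_inf[OF compact_sphere ne] by blast
  then have "w \<noteq> 0" by auto
  then have pos: "N w > 0" using N_nonneg[of w] N_eq_0[of w] by linarith
  have "norm x \<le> (1 / N w) * N x" for x
  proof (cases "x = 0")
    case False
    have "N w \<le> N ((1 / norm x) *\<^sub>R x)" using False by (intro w) auto
    then show ?thesis using False pos by (simp add: N_scale field_simps)
  qed (simp add: N_nonneg pos)
  then show thesis by (rule that)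
qed

text \<open>Turns matrix estimates into estimates along orbits. The supremum is one of reals:
  equivalence of \<open>N\<close> with the Euclidean norm bounds the set from above, and positive
  dimension makes it nonempty.\<close>

lemma induced_norm_le_iff: "induced_norm N M \<le> B \<longleftrightarrow> (\<forall>x. N (M *v x) \<le> B * N x)"
proof
  obtain c where c: "\<And>x. norm x \<le> c * N x" using norm_le_N by blast
  obtain D where D: "0 \<le> D" "\<And>x. N x \<le> D * norm x" using N.norm_bound by blast
  obtain K where K: "\<And>x. norm (M *v x) \<le> norm M * norm x * K" "K \<ge> 0"
    using bounded_bilinear.nonneg_bounded[OF bounded_bilinear_matrix_vector_mult] by blast
  have bdd: "bdd_above ((\<lambda>x. N (M *v x)) ` {x. N x = 1})"
  proof (rule bdd_aboveI2)
    fix x assume "x \<in> {x. N x = 1}"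
    then have "norm x \<le> c" using c[of x] by simp
    then have "norm (M *v x) \<le> norm M * c * K"
      using K by (meson mult_left_mono mult_right_mono norm_ge_zero order_trans)
    then show "N (M *v x) \<le> D * (norm M * c * K)"
      using D by (meson mult_left_mono order_trans)
  qed
  assume B: "induced_norm N M \<le> B"
  show "\<forall>x. N (M *v x) \<le> B * N x"
  proof
    fix x
    show "N (M *v x) \<le> B * N x"
    proof (cases "x = 0")
      case False
      then have pos: "N x > 0" using N_nonneg[of x] N_eq_0[of x] by linarith
      have "N (M *v ((1 / N x) *\<^sub>R x)) \<le> induced_norm N M"
        unfolding induced_norm_def using pos by (intro cSUP_upper[OF _ bdd]) (simp add: N_scale)
      then have "N (M *v x) \<le> induced_norm N M * N x"
        using pos by (simp add: N_scale matrix_vector_mult_scaleR field_simps)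
      also have "\<dots> \<le> B * N x" using B pos by (intro mult_right_mono) auto
      finally show ?thesis .
    qed (simp add: N.zero)
  qed
next
  assume B: "\<forall>x. N (M *v x) \<le> B * N x"
  obtain x :: "real ^ 'n" where "norm x = 1" using vector_choose_size[of 1] by auto
  then have "x \<noteq> 0" by auto
  then have "N ((1 / N x) *\<^sub>R x) = 1" using N_nonneg[of x] N_eq_0[of x] by (simp add: N_scale)
  then have "{x. N x = 1} \<noteq> {}" by blast
  then show "induced_norm N M \<le> B"
    unfolding induced_norm_def
  proof (rule cSUP_least)
    show "N (M *v x) \<le> B" if "x \<in> {x. N x = 1}" for x
      using B[rule_format, of x] that by simp
  qed
qed

lemma transition_matrix_\<Phi>: "s \<in> J \<Longrightarrow> transition_matrix \<Phi> t s *v (\<Phi> s *v v) = \<Phi> t *v v"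
  by (simp add: transition_matrix_def matrix_vector_mul_assoc[symmetric])

text \<open>One direction tests the solutions given by \<open>\<Phi>\<close>, the other uses that
  there are no others on \<open>J\<close>. Noncriticality is translated in the same way.\<close>

lemma h_expansive_iff: "h_expansive J h N A {star_unit J h..} \<longleftrightarrow> expansive"
proof
  assume "h_expansive J h N A {star_unit J h..}"
  then obtain L \<beta> where L: "L > 0" "\<beta> > 0"
    and E: "\<And>x a b t. solution J A x \<Longrightarrow> {a..b} \<subseteq> {star_unit J h..} \<Longrightarrow> t \<in> {a..b} \<Longrightarrow>
      N (x t) \<le> L * (h (star J h t (star_inv J h a)) powr (- \<beta>) * N (x a)
                   + h (star J h b (star_inv J h t)) powr (- \<beta>) * N (x b))"
    unfolding h_expansive_def by blast
  have "F t v \<le> L * (exp (- \<beta> * (t - a)) * F a v + exp (- \<beta> * (b - t)) * F b v)"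
    if "0 \<le> a" "a \<le> t" "t \<le> b" for v a b t
    using E[OF solution_\<Phi>[of v], of "g a" "g b" "g t"] that
    by (simp add: star_unit_g F_def exp_powr_real mult.commute algebra_simps)
  then show expansive unfolding expansive_def using L by blast
next
  assume expansive
  then obtain L \<beta> where L: "L > 0" "\<beta> > 0"
    and E: "\<And>v a b t. 0 \<le> a \<Longrightarrow> a \<le> t \<Longrightarrow> t \<le> b \<Longrightarrow>
      F t v \<le> L * (exp (- \<beta> * (t - a)) * F a v + exp (- \<beta> * (b - t)) * F b v)"
    unfolding expansive_def by blast
  have "N (x t) \<le> L * (h (star J h t (star_inv J h a)) powr (- \<beta>) * N (x a)
                   + h (star J h b (star_inv J h t)) powr (- \<beta>) * N (x b))"
    if x: "solution J A x" and ab: "{a..b} \<subseteq> {star_unit J h..}" and t: "t \<in> {a..b}" for x a b t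
  proof -
    obtain v where v: "\<And>t. t \<in> J \<Longrightarrow> x t = \<Phi> t *v v" using solution_imp_\<Phi>[OF x] by blast
    have a: "g 0 \<le> a" using ab t by (auto simp: star_unit_g)
    obtain a' where a': "a = g a'" "0 \<le> a'" using above_g[OF a] .
    obtain t' where t': "t = g t'" "a' \<le> t'" using above_g[of a' t] t a' by auto
    obtain b' where b': "b = g b'" "t' \<le> b'" using above_g[of t' b] t t' by auto
    show ?thesis using E[OF a'(2) t'(2) b'(2), of v] v
      by (simp add: a' t' b' F_def exp_powr_real mult.commute algebra_simps)
  qed
  then show "h_expansive J h N A {star_unit J h..}" unfolding h_expansive_def using L by blast
qed

text \<open>In logarithmic time the condition on \<open>u = g \<tau>\<close> reads
  \<open>\<bar>\<tau> - t\<bar> \<le> T\<close>; membership in \<open>J\<close> provides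
  \<open>\<tau>\<close>.\<close>

lemma window_eq:
  "{u \<in> J. star_abs J h (star J h u (star_inv J h (g t))) \<le> g T} = g ` {t - T..t + T}"
proof (intro equalityI subsetI)
  fix u assume u: "u \<in> {u \<in> J. star_abs J h (star J h u (star_inv J h (g t))) \<le> g T}"
  then obtain \<tau> where \<tau>: "u = g \<tau>" using g_ln_h by (metis (lifting) mem_Collect_eq)
  show "u \<in> g ` {t - T..t + T}" using u unfolding \<tau> by (auto simp: abs_le_iff)
qed (auto simp: abs_le_iff)

lemma uniformly_h_noncritical_iff: "uniformly_h_noncritical J h N A \<longleftrightarrow> noncritical"
proof
  assume "uniformly_h_noncritical J h N A"
  then obtain T' \<theta> where T': "T' > star_unit J h" and \<theta>: "0 < \<theta>" "\<theta> < 1"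
    and nc: "\<And>x t. solution J A x \<Longrightarrow> t \<ge> T' \<Longrightarrow>
      N (x t) \<le> \<theta> * (SUP u\<in>{u\<in>J. star_abs J h (star J h u (star_inv J h t)) \<le> T'}. N (x u))"
    unfolding uniformly_h_noncritical_def by blast
  obtain T where T: "T' = g T" using above_g[of 0 T'] T' by (auto simp: star_unit_g)
  have "F t v \<le> \<theta> * (SUP u\<in>{t - T..t + T}. F u v)" if "t \<ge> T" for v t
    using nc[OF solution_\<Phi>[of v], of "g t"] that by (simp add: T window_eq image_image F_def del: star_inv_g)
  then show noncritical
    unfolding noncritical_def using \<theta> T' by (auto simp: T star_unit_g)
next
  assume noncritical
  then obtain T \<theta> where T: "T > 0" and \<theta>: "0 < \<theta>" "\<theta> < 1"
    and nc: "\<And>v t. t \<ge> T \<Longrightarrow> F t v \<le> \<theta> * (SUP u\<in>{t - T..t + T}. F u v)"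
    unfolding noncritical_def by blast
  have "N (x t) \<le> \<theta> * (SUP u\<in>{u\<in>J. star_abs J h (star J h u (star_inv J h t)) \<le> g T}. N (x u))"
    if x: "solution J A x" and t: "t \<ge> g T" for x t
  proof -
    obtain v where v: "\<And>t. t \<in> J \<Longrightarrow> x t = \<Phi> t *v v" using solution_imp_\<Phi>[OF x] by blast
    obtain \<tau> where \<tau>: "t = g \<tau>" "T \<le> \<tau>" using above_g[OF t] .
    show ?thesis using nc[OF \<tau>(2), of v] by (simp add: \<tau> window_eq image_image v F_def del: star_inv_g)
  qed
  then show "uniformly_h_noncritical J h N A"
    unfolding uniformly_h_noncritical_def using T \<theta>
    by (intro exI[of _ "g T"] exI[of _ \<theta>] conjI) (auto simp: star_unit_g)
qed

text \<open>An implication suffices here, because bounded growth enters the theorem only as an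
  assumption.\<close>

lemma uniform_bounded_h_growth_imp:
  assumes "uniform_bounded_h_growth J h N A {star_unit J h..}"
  shows bounded_growth
proof -
  obtain T' C where T': "T' > star_unit J h" and C: "C \<ge> 1"
    and G: "\<And>x s t. solution J A x \<Longrightarrow> s \<in> {star_unit J h..} \<Longrightarrow>
      t \<in> {s..star J h s T'} \<inter> {star_unit J h..} \<Longrightarrow> N (x t) \<le> C * N (x s)"
    using assms unfolding uniform_bounded_h_growth_def by blast
  obtain T where T: "T' = g T" using above_g[of 0 T'] T' by (auto simp: star_unit_g)
  have "F t v \<le> C * F s v" if "0 \<le> s" "s \<le> t" "t \<le> s + T" for v s t
    using G[OF solution_\<Phi>[of v], of "g s" "g t"] that by (simp add: T star_unit_g F_def)
  then show ?thesis
    unfolding bounded_growth_def using C T'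
    by (intro exI[of _ T] exI[of _ C] conjI) (auto simp: T star_unit_g)
qed

text \<open>The projectors \<open>P t\<close> and the constant projection \<open>Q\<close> determine
  each other by conjugation with \<open>\<Phi> t\<close>. The vectors
  \<open>\<Phi> (g s) *v v\<close> exhaust the space, so the induced norm bounds become bounds on
  \<open>F\<close>.\<close>

lemma uniform_h_dichotomy_iff: "uniform_h_dichotomy J h N \<Phi> {star_unit J h..} \<longleftrightarrow> dichotomic"
proof
  assume "uniform_h_dichotomy J h N \<Phi> {star_unit J h..}"
  then obtain P K \<alpha> where K: "K \<ge> 1" "\<alpha> > 0"
    and PP: "\<And>t. t \<in> J \<Longrightarrow> P t ** P t = P t"
    and comm: "\<And>t s. t \<in> J \<Longrightarrow> s \<in> J \<Longrightarrow>
      P t ** transition_matrix \<Phi> t s = transition_matrix \<Phi> t s ** P s"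
    and st: "\<And>t s. t \<ge> g 0 \<Longrightarrow> s \<ge> g 0 \<Longrightarrow> t \<ge> s \<Longrightarrow>
      induced_norm N (transition_matrix \<Phi> t s ** P s) \<le> K * (h t / h s) powr (- \<alpha>)"
    and un: "\<And>t s. t \<ge> g 0 \<Longrightarrow> s \<ge> g 0 \<Longrightarrow> s \<ge> t \<Longrightarrow>
      induced_norm N (transition_matrix \<Phi> t s ** (mat 1 - P s)) \<le> K * (h s / h t) powr (- \<alpha>)"
    unfolding uniform_h_dichotomy_def star_unit_g atLeast_iff by (elim exE conjE) (rule that; blast)
  \<comment> \<open>Conjugation is done at the unit \<open>g 0\<close> only; commutation with the
    transition matrix from \<open>g 0\<close> to \<open>t\<close> carries it to every
    \<open>t\<close> in \<open>J\<close>.\<close>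
  define Q where "Q v = matrix_inv (\<Phi> (g 0)) *v (P (g 0) *v (\<Phi> (g 0) *v v))" for v
  have "linear Q"
    by (rule linearI) (auto simp: Q_def matrix_vector_right_distrib matrix_vector_mult_scaleR)
  moreover have "Q (Q v) = Q v" for v
  proof -
    have "P (g 0) *v (P (g 0) *v w) = P (g 0) *v w" for w
      using PP[of "g 0"] by (simp add: matrix_vector_mul_assoc)
    then show ?thesis by (simp add: Q_def)
  qed
  moreover have \<Phi>Q: "\<Phi> t *v Q v = P t *v (\<Phi> t *v v)" if "t \<in> J" for t v
  proof -
    have "P t *v (\<Phi> t *v v) = (P t ** transition_matrix \<Phi> t (g 0)) *v (\<Phi> (g 0) *v v)"
      by (simp add: matrix_vector_mul_assoc[symmetric] transition_matrix_\<Phi>)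
    also have "\<dots> = transition_matrix \<Phi> t (g 0) *v (P (g 0) *v (\<Phi> (g 0) *v v))"
      using comm[OF that g_in_J] by (simp add: matrix_vector_mul_assoc matrix_mul_assoc)
    also have "\<dots> = \<Phi> t *v Q v"
      by (simp add: transition_matrix_def Q_def matrix_vector_mul_assoc[symmetric])
    finally show ?thesis ..
  qed
  have "F t (Q v) \<le> K * exp (- \<alpha> * (t - s)) * F s v" if "0 \<le> s" "s \<le> t" for s t v
  proof -
    have "transition_matrix \<Phi> (g t) (g s) ** P (g s) *v (\<Phi> (g s) *v v) = \<Phi> (g t) *v Q v"
      by (simp add: matrix_vector_mul_assoc[symmetric] \<Phi>Q[symmetric] transition_matrix_\<Phi>)
    moreover have "induced_norm N (transition_matrix \<Phi> (g t) (g s) ** P (g s)) \<le> K * exp (- \<alpha> * (t - s))"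
      using st[of "g t" "g s"] that unfolding h_ratio_powr by simp
    ultimately show ?thesis unfolding induced_norm_le_iff F_def by metis
  qed
  moreover have "F t (v - Q v) \<le> K * exp (- \<alpha> * (s - t)) * F s v" if "0 \<le> t" "t \<le> s" for s t v
  proof -
    have "transition_matrix \<Phi> (g t) (g s) ** (mat 1 - P (g s)) *v (\<Phi> (g s) *v v) = \<Phi> (g t) *v (v - Q v)"
      by (simp add: matrix_vector_mul_assoc[symmetric] matrix_vector_mult_diff_rdistrib
          matrix_vector_mult_diff_distrib \<Phi>Q[symmetric] transition_matrix_\<Phi>)
    moreover have "induced_norm N (transition_matrix \<Phi> (g t) (g s) ** (mat 1 - P (g s))) \<le> K * exp (- \<alpha> * (s - t))"
      using un[of "g t" "g s"] that unfolding h_ratio_powr by simp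
    ultimately show ?thesis unfolding induced_norm_le_iff F_def by metis
  qed
  ultimately show dichotomic unfolding dichotomic_def using K by blast
next
  assume dichotomic
  then obtain Q K \<alpha> where Q: "linear Q" "\<And>v. Q (Q v) = Q v" and K: "K \<ge> 1" "\<alpha> > 0"
    and st: "\<And>s t v. 0 \<le> s \<Longrightarrow> s \<le> t \<Longrightarrow> F t (Q v) \<le> K * exp (- \<alpha> * (t - s)) * F s v"
    and un: "\<And>s t v. 0 \<le> t \<Longrightarrow> t \<le> s \<Longrightarrow> F t (v - Q v) \<le> K * exp (- \<alpha> * (s - t)) * F s v"
    unfolding dichotomic_def by blast
  \<comment> \<open>Transporting \<open>Q\<close> along \<open>\<Phi>\<close> makes commutation with
    the transition matrices automatic, as the inner factors cancel.\<close>
  define P where "P t = \<Phi> t ** matrix Q ** matrix_inv (\<Phi> t)" for t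
  have P: "P t *v w = \<Phi> t *v Q (matrix_inv (\<Phi> t) *v w)" for t w
    using Q(1) by (simp add: P_def matrix_vector_mul_assoc[symmetric])
  have tr: "transition_matrix \<Phi> t s *v w = \<Phi> t *v (matrix_inv (\<Phi> s) *v w)" for t s w
    by (simp add: transition_matrix_def matrix_vector_mul_assoc)
  have "P t ** P t = P t" if "t \<in> J" for t
    using that Q(2) by (simp add: matrix_eq matrix_vector_mul_assoc[symmetric] P)
  moreover have "P t ** transition_matrix \<Phi> t s = transition_matrix \<Phi> t s ** P s"
    if "t \<in> J" "s \<in> J" for t s
    using that by (simp add: matrix_eq matrix_vector_mul_assoc[symmetric] P tr)
  moreover have "induced_norm N (transition_matrix \<Phi> t s ** P s) \<le> K * (h t / h s) powr (- \<alpha>)"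
    if ts: "t \<ge> g 0" "s \<ge> g 0" "t \<ge> s" for t s
  proof -
    obtain s' where s': "s = g s'" "0 \<le> s'" using above_g[OF ts(2)] .
    obtain t' where t': "t = g t'" "s' \<le> t'" using above_g[of s' t] ts s' by auto
    show ?thesis unfolding induced_norm_le_iff s' t' h_ratio_powr
    proof
      fix x
      show "N (transition_matrix \<Phi> (g t') (g s') ** P (g s') *v x) \<le> K * exp (- \<alpha> * (t' - s')) * N x"
        using st[OF s'(2) t'(2), of "matrix_inv (\<Phi> (g s')) *v x"]
        by (simp add: matrix_vector_mul_assoc[symmetric] P tr F_def)
    qed
  qed
  moreover have "induced_norm N (transition_matrix \<Phi> t s ** (mat 1 - P s)) \<le> K * (h s / h t) powr (- \<alpha>)"
    if ts: "t \<ge> g 0" "s \<ge> g 0" "s \<ge> t" for t s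
  proof -
    obtain t' where t': "t = g t'" "0 \<le> t'" using above_g[OF ts(1)] .
    obtain s' where s': "s = g s'" "t' \<le> s'" using above_g[of t' s] ts t' by auto
    show ?thesis unfolding induced_norm_le_iff s' t' h_ratio_powr
    proof
      fix x
      show "N (transition_matrix \<Phi> (g t') (g s') ** (mat 1 - P (g s')) *v x) \<le> K * exp (- \<alpha> * (s' - t')) * N x"
        using un[OF t'(2) s'(2), of "matrix_inv (\<Phi> (g s')) *v x"]
        by (simp add: matrix_vector_mul_assoc[symmetric] matrix_vector_mult_diff_rdistrib
            matrix_vector_mult_diff_distrib P tr F_def)
    qed
  qed
  ultimately show "uniform_h_dichotomy J h N \<Phi> {star_unit J h..}"
    unfolding uniform_h_dichotomy_def star_unit_g atLeast_iff using K by blast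
qed

end

theorem theorem2:
  fixes J :: "real set"
    and A \<Phi> :: "real \<Rightarrow> real ^ 'n ^ 'n"
    and N :: "real ^ 'n \<Rightarrow> real"
    and h :: "real \<Rightarrow> real"
  assumes "admissible_domain J"
    and "continuous_on J A"
    and "fundamental_matrix J A \<Phi>"
    and "vector_norm N"
    and "growth_rate J h"
  shows "(uniform_bounded_h_growth J h N A {star_unit J h..} \<longrightarrow>
            (uniform_h_dichotomy J h N \<Phi> {star_unit J h..} \<longleftrightarrow>
               h_expansive J h N A {star_unit J h..}) \<and>
            (h_expansive J h N A {star_unit J h..} \<longleftrightarrow>
               uniformly_h_noncritical J h N A)) \<and>
         (uniform_h_dichotomy J h N \<Phi> {star_unit J h..} \<longrightarrow>
            h_expansive J h N A {star_unit J h..}) \<and>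
         (h_expansive J h N A {star_unit J h..} \<longrightarrow>
            uniformly_h_noncritical J h N A)"
proof -
  interpret linear_system J A \<Phi> N h
    using assms by unfold_locales
  show ?thesis
    unfolding h_expansive_iff uniformly_h_noncritical_iff uniform_h_dichotomy_iff
    using uniform_bounded_h_growth_imp noncritical_imp_dichotomic dichotomic_imp_expansive
      expansive_imp_noncritical by blast
qed

end
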